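(* There is an absolute constant $c>0$ such that for all integers $n\ge 2$, $q\ge 1$, $m\ge 1$ and every antichain $A=\{\alpha_0,\ldots,\alpha_{n-1}\}\subset\{0,1\}^m$ of cardinality $n$ (with this fixed indexing), $$L(S_{q,A}) \le L(A) + c\, q n \log_2 n .$$
   Context: $L(F)$ denotes the minimal number of gates in a circuit over the basis $\{\vee,\wedge\}$ (binary disjunction and conjunction gates, inputs being the variables) computing the (possibly partially defined) boolean operator $F$; a circuit computes a partially defined operator if its outputs agree with $F$ on every input where $F$ is defined. Let $X=(x_0,\ldots,x_{n-1})$ with $x_i=(x_{i,0},\ldots,x_{i,q-1})^T$ be a $q\times n$ matrix of boolean variables, and $Y=(y_0,\ldots,y_{m-1})$ a vector of boolean variables. For a vector (or sequence of columns) $v=(v_0,\ldots,v_{n-1})$, $v\gg k$ denotes its cyclic shift by $k$ positions to the right, i.e. the sequence whose entry at position $(j+k)\bmod n$ is $v_j$. The monotone cyclic shift operator $S_{q,A}(X,Y)=(s_0,\ldots,s_{n-1})$ (with $nq+m$ inputs and $nq$ outputs) is the partially defined operator defined only for $Y\in A$, with $S_{q,A}(X,\alpha_k)=X\gg k$ for $k=0,\ldots,n-1$ and all $X\in\{0,1\}^{q\times n}$. For $v\in\{0,1\}^m$ let $Y^v=\bigwedge_{i: v_i=1} y_i$; $L(A)$ denotes the minimal number of gates of a circuit over $\{\vee,\wedge\}$ computing simultaneously all monomials $Y^{\alpha}$, $\alpha\in A$. *)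

theory Defs
  imports "HOL-Library.Extended_Real"
begin

section \<open>Circuits over the basis of binary disjunction and conjunction\<close>

text \<open>A circuit is a list of gates in topological order together with an assignment of a node to
  every output; the node \<open>Gate t\<close> is the \<open>t\<close>-th gate of the list. Outputs may be input variables.
  There are no constants.\<close>

datatype 'v node = Var 'v | Gate nat

datatype 'v gate = Conj_gate "'v node" "'v node" | Disj_gate "'v node" "'v node"

fun node_ok :: "'v set \<Rightarrow> nat \<Rightarrow> 'v node \<Rightarrow> bool" where
  "node_ok V t (Var v) \<longleftrightarrow> v \<in> V"
| "node_ok V t (Gate s) \<longleftrightarrow> s < t"

fun gate_ok :: "'v set \<Rightarrow> nat \<Rightarrow> 'v gate \<Rightarrow> bool" where
  "gate_ok V t (Conj_gate u w) \<longleftrightarrow> node_ok V t u \<and> node_ok V t w"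
| "gate_ok V t (Disj_gate u w) \<longleftrightarrow> node_ok V t u \<and> node_ok V t w"

definition circuit :: "'v set \<Rightarrow> 'o set \<Rightarrow> 'v gate list \<Rightarrow> ('o \<Rightarrow> 'v node) \<Rightarrow> bool" where
  "circuit V Out gs out \<longleftrightarrow>
     (\<forall>t < length gs. gate_ok V t (gs ! t)) \<and> (\<forall>z \<in> Out. node_ok V (length gs) (out z))"

fun node_val :: "('v \<Rightarrow> bool) \<Rightarrow> bool list \<Rightarrow> 'v node \<Rightarrow> bool" where
  "node_val a vs (Var v) = a v"
| "node_val a vs (Gate t) = vs ! t"

fun gate_val :: "('v \<Rightarrow> bool) \<Rightarrow> bool list \<Rightarrow> 'v gate \<Rightarrow> bool" where
  "gate_val a vs (Conj_gate u w) \<longleftrightarrow> node_val a vs u \<and> node_val a vs w"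
| "gate_val a vs (Disj_gate u w) \<longleftrightarrow> node_val a vs u \<or> node_val a vs w"

definition gates_val :: "('v \<Rightarrow> bool) \<Rightarrow> 'v gate list \<Rightarrow> bool list" where
  "gates_val a gs = foldl (\<lambda>vs g. vs @ [gate_val a vs g]) [] gs"

text \<open>A partially defined operator maps an assignment of the variables to the values of its
  outputs, or to \<open>None\<close> where it is undefined.\<close>

type_synonym ('v, 'o) partial_operator = "('v \<Rightarrow> bool) \<Rightarrow> ('o \<Rightarrow> bool) option"

definition computes ::
  "'o set \<Rightarrow> 'v gate list \<Rightarrow> ('o \<Rightarrow> 'v node) \<Rightarrow> ('v, 'o) partial_operator \<Rightarrow> bool" where
  "computes Out gs out F \<longleftrightarrow>
     (\<forall>a b. F a = Some b \<longrightarrow> (\<forall>z \<in> Out. node_val a (gates_val a gs) (out z) = b z))"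

text \<open>The value is \<open>\<infinity>\<close> if no circuit computes the operator.\<close>

definition complexity :: "'v set \<Rightarrow> 'o set \<Rightarrow> ('v, 'o) partial_operator \<Rightarrow> enat" where
  "complexity V Out F =
     Inf {enat (length gs) | gs out. circuit V Out gs out \<and> computes Out gs out F}"

section \<open>Monomials\<close>

definition monomial :: "bool list \<Rightarrow> (nat \<Rightarrow> bool) \<Rightarrow> bool" where
  "monomial v y \<longleftrightarrow> (\<forall>i < length v. v ! i \<longrightarrow> y i)"

text \<open>The outputs of the operator are indexed by the elements of \<open>A\<close> themselves.\<close>

definition monomials_complexity :: "nat \<Rightarrow> bool list set \<Rightarrow> enat" where
  "monomials_complexity m A = complexity {..<m} A (\<lambda>y. Some (\<lambda>v. monomial v y))"

definition antichain :: "bool list set \<Rightarrow> bool" where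
  "antichain A \<longleftrightarrow> (\<forall>u \<in> A. \<forall>v \<in> A. u \<noteq> v \<longrightarrow> \<not> list_all2 (\<le>) u v)"

section \<open>The monotone cyclic shift operator\<close>

definition cyclic_shift :: "nat \<Rightarrow> (nat \<Rightarrow> 'a) \<Rightarrow> nat \<Rightarrow> (nat \<Rightarrow> 'a)" where
  "cyclic_shift n v k = (\<lambda>p. v (nat ((int p - int k) mod int n)))"

lemma cyclic_shift_apply:
  assumes "j < n"
  shows "cyclic_shift n v k ((j + k) mod n) = v j"
proof -
  have "(int ((j + k) mod n) - int k) mod int n = int j mod int n"
    by (simp add: zmod_int mod_diff_left_eq)
  then show ?thesis
    using assms by (simp add: cyclic_shift_def)
qed

text \<open>\<open>X j i\<close> is the variable $x_{j,i}$ in row \<open>i\<close> of column \<open>j\<close>.\<close>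

datatype shift_var = X nat nat | Y nat

definition shift_vars :: "nat \<Rightarrow> nat \<Rightarrow> nat \<Rightarrow> shift_var set" where
  "shift_vars q n m = {X j i | j i. j < n \<and> i < q} \<union> {Y i | i. i < m}"

text \<open>The output \<open>(p, i)\<close> is the \<open>i\<close>-th entry of the column $s_p$. The set \<open>A\<close> and its indexing are
  given by \<open>\<alpha>\<close>, which is meant to be injective on \<open>{..<n}\<close>.\<close>

definition shift_operator ::
  "nat \<Rightarrow> nat \<Rightarrow> (nat \<Rightarrow> bool list) \<Rightarrow> (shift_var, nat \<times> nat) partial_operator" where
  "shift_operator n m \<alpha> a =
     (let y = map (\<lambda>i. a (Y i)) [0..<m] in
      if y \<in> \<alpha> ` {..<n}
      then Some (\<lambda>(p, i). cyclic_shift n (\<lambda>j i. a (X j i)) (THE k. k < n \<and> \<alpha> k = y) p i)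
      else None)"

lemma shift_operator_apply:
  assumes "inj_on \<alpha> {..<n}" "k < n" "map (\<lambda>i. a (Y i)) [0..<m] = \<alpha> k"
  shows "shift_operator n m \<alpha> a = Some (\<lambda>(p, i). cyclic_shift n (\<lambda>j i. a (X j i)) k p i)"
proof -
  have "(THE k'. k' < n \<and> \<alpha> k' = \<alpha> k) = k"
    using assms(1,2) by (intro the_equality) (auto dest: inj_onD)
  then show ?thesis
    using assms(2,3) by (simp add: shift_operator_def)
qed

definition shift_complexity :: "nat \<Rightarrow> nat \<Rightarrow> nat \<Rightarrow> (nat \<Rightarrow> bool list) \<Rightarrow> enat" where
  "shift_complexity q n m \<alpha> =
     complexity (shift_vars q n m) ({..<n} \<times> {..<q}) (shift_operator n m \<alpha>)"

end

theory Submission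
  imports Defs
begin

text \<open>On the antichain \<open>A\<close> the monomials of its elements form a one-hot encoding of the shift
  amount \<open>k\<close>. Hence each binary digit of \<open>k\<close> and also its negation is a disjunction of monomials,
  and a barrel shifter, whose level \<open>t\<close> rotates by \<open>2\<^sup>t\<close> or by \<open>0\<close>, needs no negation gates.\<close>

section \<open>Sets of functions computable with a given number of gates\<close>

lemma gates_val_snoc:
  "gates_val a (gs @ [g]) = gates_val a gs @ [gate_val a (gates_val a gs) g]"
  by (simp add: gates_val_def)

lemma length_gates_val [simp]: "length (gates_val a gs) = length gs"
  by (induction gs rule: rev_induct) (simp_all add: gates_val_snoc, simp add: gates_val_def)

lemma node_ok_mono: "node_ok V s u \<Longrightarrow> s \<le> t \<Longrightarrow> node_ok V t u"
  by (cases u) auto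

lemma node_val_append:
  "node_ok V (length vs) u \<Longrightarrow> node_val a (vs @ ws) u = node_val a vs u"
  by (cases u) (auto simp: nth_append)

text \<open>Semantic view of a circuit: nodes are replaced by the total functions they compute, so
  that gate indices disappear from later arguments. Variables in \<open>V\<close> belong to it
  without costing a gate.\<close>

definition node_functions :: "'v set \<Rightarrow> 'v gate list \<Rightarrow> (('v \<Rightarrow> bool) \<Rightarrow> bool) set" where
  "node_functions V gs = {\<lambda>a. node_val a (gates_val a gs) u | u. node_ok V (length gs) u}"

definition gates_ok :: "'v set \<Rightarrow> 'v gate list \<Rightarrow> bool" where
  "gates_ok V gs \<longleftrightarrow> (\<forall>t < length gs. gate_ok V t (gs ! t))"

text \<open>A single circuit serves all of \<open>S\<close>, so shared subcircuits are counted once.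
  The bound \<open>N\<close> is an upper bound, which makes the notion monotone.\<close>

definition computable_within :: "'v set \<Rightarrow> nat \<Rightarrow> (('v \<Rightarrow> bool) \<Rightarrow> bool) set \<Rightarrow> bool" where
  "computable_within V N S \<longleftrightarrow>
     (\<exists>gs. gates_ok V gs \<and> length gs \<le> N \<and> S \<subseteq> node_functions V gs)"

lemma computable_within_mono:
  "computable_within V N S \<Longrightarrow> N \<le> N' \<Longrightarrow> S' \<subseteq> S \<Longrightarrow> computable_within V N' S'"
  unfolding computable_within_def by (meson le_trans subset_trans)

lemma node_functions_snoc: "node_functions V gs \<subseteq> node_functions V (gs @ [g])"
proof
  fix f assume "f \<in> node_functions V gs"
  then obtain u where u: "node_ok V (length gs) u"
    and f: "f = (\<lambda>a. node_val a (gates_val a gs) u)"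
    by (auto simp: node_functions_def)
  have "f = (\<lambda>a. node_val a (gates_val a (gs @ [g])) u)"
    using u by (simp add: f gates_val_snoc node_val_append[of V])
  moreover have "node_ok V (length (gs @ [g])) u"
    using u by (rule node_ok_mono) simp
  ultimately show "f \<in> node_functions V (gs @ [g])"
    by (auto simp: node_functions_def)
qed

lemma computable_within_gate:
  assumes "computable_within V N S" "f \<in> S" "g \<in> S"
    and h: "h = (\<lambda>a. f a \<and> g a) \<or> h = (\<lambda>a. f a \<or> g a)"
  shows "computable_within V (Suc N) (insert h S)"
proof -
  obtain gs where gs: "gates_ok V gs" "length gs \<le> N" "S \<subseteq> node_functions V gs"
    using assms(1) by (auto simp: computable_within_def)
  obtain u w where u: "node_ok V (length gs) u" "f = (\<lambda>a. node_val a (gates_val a gs) u)"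
    and w: "node_ok V (length gs) w" "g = (\<lambda>a. node_val a (gates_val a gs) w)"
    using assms(2,3) gs(3) unfolding node_functions_def by blast
  obtain e where e: "gate_ok V (length gs) e" "h = (\<lambda>a. gate_val a (gates_val a gs) e)"
    using h
  proof
    assume "h = (\<lambda>a. f a \<and> g a)"
    then show thesis using u w by (intro that[of "Conj_gate u w"]) auto
  next
    assume "h = (\<lambda>a. f a \<or> g a)"
    then show thesis using u w by (intro that[of "Disj_gate u w"]) auto
  qed
  have "gates_ok V (gs @ [e])"
    using gs(1) e(1) by (auto simp: gates_ok_def nth_append less_Suc_eq)
  moreover have "h \<in> node_functions V (gs @ [e])"
    unfolding node_functions_def
    by (intro CollectI exI[of _ "Gate (length gs)"]) (simp add: e(2) gates_val_snoc nth_append)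
  ultimately show ?thesis
    using gs node_functions_snoc[of V gs e] unfolding computable_within_def
    by (intro exI[of _ "gs @ [e]"]) auto
qed

text \<open>Each new gate reads only functions in \<open>S\<close>, which remain available, so the
  gates can be appended one after another in any order.\<close>

lemma computable_within_layer:
  assumes "finite I" "computable_within V N S"
    and "\<And>i. i \<in> I \<Longrightarrow>
           \<exists>f\<in>S. \<exists>g\<in>S. h i = (\<lambda>a. f a \<and> g a) \<or> h i = (\<lambda>a. f a \<or> g a)"
  shows "computable_within V (N + card I) (S \<union> h ` I)"
  using assms
proof (induction I rule: finite_induct)
  case empty
  then show ?case by simp
next
  case (insert i I)
  have "computable_within V (N + card I) (S \<union> h ` I)"
    using insert by blast
  moreover obtain f g where "f \<in> S" "g \<in> S"
    "h i = (\<lambda>a. f a \<and> g a) \<or> h i = (\<lambda>a. f a \<or> g a)"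
    using insert.prems(2) by blast
  ultimately have "computable_within V (Suc (N + card I)) (insert (h i) (S \<union> h ` I))"
    by (intro computable_within_gate[of V "N + card I" _ f g]) auto
  then show ?case
    using insert.hyps by simp
qed

text \<open>Nonemptiness matters: there are no constant gates, so the empty disjunction need not be
  available. One gate fewer would suffice; \<open>card K\<close> avoids a subtraction.\<close>

lemma computable_within_Disj:
  assumes "finite K" "K \<noteq> {}" "computable_within V N S" "\<And>k. k \<in> K \<Longrightarrow> z k \<in> S"
  shows "computable_within V (N + card K) (insert (\<lambda>a. \<exists>k\<in>K. z k a) S)"
  using assms
proof (induction K rule: finite_ne_induct)
  case (singleton k)
  then show ?case
    by (auto simp: insert_absorb intro: computable_within_mono)
next
  case (insert k K)
  let ?S = "insert (\<lambda>a. \<exists>k\<in>K. z k a) S"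
  have "computable_within V (N + card K) ?S"
    using insert by blast
  then have "computable_within V (Suc (N + card K)) (insert (\<lambda>a. \<exists>k\<in>insert k K. z k a) ?S)"
    using insert.prems(2)
    by (intro computable_within_gate[where f = "z k" and g = "\<lambda>a. \<exists>k\<in>K. z k a"]) auto
  then show ?case
    by (rule computable_within_mono) (use insert.hyps in auto)
qed

section \<open>Passing between \<open>complexity\<close> and
  \<open>computable_within\<close>\<close>

text \<open>The functions \<open>f z\<close> are total, but have to agree with \<open>F\<close> only
  where \<open>F\<close> is defined.\<close>

lemma complexity_le_if_computable_within:
  assumes "computable_within V N (f ` Out)"
    and "\<And>a b z. F a = Some b \<Longrightarrow> z \<in> Out \<Longrightarrow> f z a = b z"
  shows "complexity V Out F \<le> enat N"
proof -
  obtain gs where gs: "gates_ok V gs" "length gs \<le> N" "f ` Out \<subseteq> node_functions V gs"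
    using assms(1) by (auto simp: computable_within_def)
  have "\<exists>u. node_ok V (length gs) u \<and> f z = (\<lambda>a. node_val a (gates_val a gs) u)" if "z \<in> Out" for z
    using gs(3) that by (auto simp: node_functions_def)
  then obtain out where out: "\<And>z. z \<in> Out \<Longrightarrow> node_ok V (length gs) (out z)"
      "\<And>z. z \<in> Out \<Longrightarrow> f z = (\<lambda>a. node_val a (gates_val a gs) (out z))"
    by metis
  have "node_val a (gates_val a gs) (out z) = b z" if "F a = Some b" "z \<in> Out" for a b z
    using assms(2)[OF that] out(2)[OF that(2)] by simp
  then have "circuit V Out gs out \<and> computes Out gs out F"
    using gs(1) out(1) by (simp add: circuit_def computes_def gates_ok_def)
  then have "complexity V Out F \<le> enat (length gs)"
    unfolding complexity_def by (intro Inf_lower) blast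
  then show ?thesis
    using gs(2) by (meson enat_ord_simps(1) order_trans)
qed

text \<open>A finite infimum comes from a nonempty set, and \<open>enat\<close> is well-ordered, so
  an optimal circuit exists.\<close>

lemma complexity_attained:
  assumes "complexity V Out F = enat N"
  obtains gs out where "circuit V Out gs out" "computes Out gs out F" "length gs = N"
proof -
  let ?C = "{enat (length gs) | gs out. circuit V Out gs out \<and> computes Out gs out F}"
  have "?C \<noteq> {}"
  proof
    assume "?C = {}"
    then have "complexity V Out F = \<infinity>"
      unfolding complexity_def by (simp only: Inf_enat_def simp_thms if_True)
    then show False using assms by simp
  qed
  then have "Inf ?C \<in> ?C"
    using wellorder_InfI[of _ ?C] by (simp only: ex_in_conv[symmetric]) (elim exE)
  then show thesis
    using assms that unfolding complexity_def by auto
qed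

section \<open>Substituting variables\<close>

lemma node_val_map_node: "node_val a vs (map_node \<rho> u) = node_val (a \<circ> \<rho>) vs u"
  by (cases u) auto

lemma gates_val_map_gate: "gates_val a (map (map_gate \<rho>) gs) = gates_val (a \<circ> \<rho>) gs"
proof (induction gs rule: rev_induct)
  case Nil
  then show ?case by (simp add: gates_val_def)
next
  case (snoc g gs)
  have "gate_val a vs (map_gate \<rho> g) = gate_val (a \<circ> \<rho>) vs g" for vs
    by (cases g) (auto simp: node_val_map_node)
  then show ?case
    using snoc by (simp add: gates_val_snoc comp_def)
qed

lemma node_ok_map_node: "node_ok V t u \<Longrightarrow> \<rho> ` V \<subseteq> W \<Longrightarrow> node_ok W t (map_node \<rho> u)"
  by (cases u) auto

lemma gate_ok_map_gate: "gate_ok V t g \<Longrightarrow> \<rho> ` V \<subseteq> W \<Longrightarrow> gate_ok W t (map_gate \<rho> g)"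
  by (cases g) (auto simp: node_ok_map_node)

text \<open>Renaming the variables of an optimal circuit keeps its gate count. It is used with
  \<open>Y\<close> for \<open>\<rho>\<close>, to place a circuit for the monomials among the
  variables of the shift operator; the variables in \<open>W\<close> come for free.\<close>

lemma computable_within_substitute:
  assumes "complexity V Out (\<lambda>y. Some (\<lambda>z. f z y)) = enat N" "\<rho> ` V \<subseteq> W"
  shows "computable_within W N ((\<lambda>z a. f z (a \<circ> \<rho>)) ` Out \<union> (\<lambda>v a. a v) ` W)"
proof -
  obtain gs out where gs: "circuit V Out gs out"
      "computes Out gs out (\<lambda>y. Some (\<lambda>z. f z y))" "length gs = N"
    using complexity_attained[OF assms(1)] .
  let ?gs = "map (map_gate \<rho>) gs"
  have "(\<lambda>a. f z (a \<circ> \<rho>)) \<in> node_functions W ?gs" if "z \<in> Out" for z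
    unfolding node_functions_def using gs(1,2) assms(2) that
    by (intro CollectI exI[of _ "map_node \<rho> (out z)"])
       (auto simp: gates_val_map_gate node_val_map_node circuit_def computes_def
             intro: node_ok_map_node)
  moreover have "(\<lambda>a. a v) \<in> node_functions W ?gs" if "v \<in> W" for v
    unfolding node_functions_def using that by (intro CollectI exI[of _ "Var v"]) simp
  moreover have "gates_ok W ?gs"
    using gs(1) assms(2) by (auto simp: gates_ok_def circuit_def intro: gate_ok_map_gate)
  ultimately show ?thesis
    unfolding computable_within_def using gs(3) by (intro exI[of _ ?gs]) auto
qed

section \<open>The barrel shifter\<close>

context
  fixes n :: nat and z :: "nat \<Rightarrow> (shift_var \<Rightarrow> bool) \<Rightarrow> bool"
begin

text \<open>Here \<open>z k\<close> is meant to indicate that the shift amount is \<open>k\<close>.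
  The parameter \<open>d\<close> provides a digit and its complement as two positive disjunctions;
  they are complementary only when exactly one \<open>z k\<close> with \<open>k < n\<close>
  holds.\<close>

definition digit_is :: "bool \<Rightarrow> nat \<Rightarrow> (shift_var \<Rightarrow> bool) \<Rightarrow> bool" where
  "digit_is d t = (\<lambda>a. \<exists>k \<in> {k. k < n \<and> bit k t = d}. z k a)"

text \<open>A multiplexer at each position: a right rotation by \<open>2 ^ t\<close> brings to
  \<open>p\<close> the entry at \<open>p - 2 ^ t\<close>. The subtraction is done in the integers
  since it may be negative before reduction modulo \<open>n\<close>.\<close>

fun barrel :: "nat \<Rightarrow> nat \<times> nat \<Rightarrow> (shift_var \<Rightarrow> bool) \<Rightarrow> bool" where
  "barrel 0 (p, i) = (\<lambda>a. a (X p i))"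
| "barrel (Suc t) (p, i) =
     (\<lambda>a. digit_is True t a \<and> barrel t (nat ((int p - 2 ^ t) mod int n), i) a
        \<or> digit_is False t a \<and> barrel t (p, i) a)"

text \<open>The first \<open>t\<close> levels process the \<open>t\<close> lowest digits of
  \<open>k\<close>, so their rotations add up to \<open>take_bit t k\<close>. The position stays
  arbitrary in the induction because the recursive call looks at a rotated one.\<close>

lemma barrel_eq:
  assumes "k < n" "\<And>j. j < n \<Longrightarrow> z j a \<longleftrightarrow> j = k" "p < n"
  shows "barrel t (p, i) a = a (X (nat ((int p - int (take_bit t k)) mod int n)) i)"
  using \<open>p < n\<close>
proof (induction t arbitrary: p)
  case 0
  then show ?case by simp
next
  case (Suc t)
  have digit: "digit_is d t a \<longleftrightarrow> bit k t = d" for d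
    using assms(1,2) by (auto simp: digit_is_def)
  show ?case
  proof (cases "bit k t")
    case True
    have "nat ((int p - 2 ^ t) mod int n) < n"
      using assms(1) by (simp add: nat_less_iff)
    then have "barrel t (nat ((int p - 2 ^ t) mod int n), i) a
        = a (X (nat ((int p - 2 ^ t - int (take_bit t k)) mod int n)) i)"
      using assms(1) by (simp add: Suc.IH mod_diff_left_eq)
    then show ?thesis
      using True by (simp add: digit take_bit_Suc_from_most algebra_simps)
  next
    case False
    then show ?thesis
      using Suc by (simp add: digit take_bit_Suc_from_most)
  qed
qed

lemma computable_within_digit_is:
  assumes "computable_within V N S" "z ` {..<n} \<subseteq> S" "2 ^ t < n"
  shows "computable_within V (N + n) (insert (digit_is d t) S)"
proof -
  let ?K = "{k. k < n \<and> bit k t = d}"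
  \<comment> \<open>The disjunction is nonempty for both values of \<open>d\<close>:
    \<open>2 ^ t\<close> has digit \<open>t\<close> set and \<open>0\<close> does not, and both are
    below \<open>n\<close>.\<close>
  have "(if d then 2 ^ t else 0) \<in> ?K"
    using assms(3) by (auto simp: bit_exp_iff)
  moreover have "card ?K \<le> n"
    using card_mono[of "{..<n}" ?K] by auto
  moreover have "finite ?K" by simp
  ultimately have "computable_within V (N + card ?K) (insert (digit_is d t) S)"
    unfolding digit_is_def using assms(1,2)
    by (intro computable_within_Disj) auto
  then show ?thesis
    by (rule computable_within_mono) (use \<open>card ?K \<le> n\<close> in auto)
qed

text \<open>The functions \<open>z k\<close> are carried along because every level builds its own
  two digit functions from them.\<close>

lemma computable_within_barrel:
  assumes "computable_within V N (z ` {..<n} \<union> barrel 0 ` ({..<n} \<times> {..<q}))"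
    and "\<And>s. s < t \<Longrightarrow> 2 ^ s < n" "q \<ge> 1"
  shows "computable_within V (N + 5 * q * n * t) (z ` {..<n} \<union> barrel t ` ({..<n} \<times> {..<q}))"
  using assms(2)
proof (induction t)
  case 0
  then show ?case using assms(1) by simp
next
  case (Suc t)
  let ?I = "{..<n} \<times> {..<q}"
  define S where "S = z ` {..<n} \<union> barrel t ` ?I"
  define S1 where "S1 = insert (digit_is False t) (insert (digit_is True t) S)"
  define rot where "rot = (\<lambda>(p, i :: nat) a. digit_is True t a \<and>
      barrel t (nat ((int p - 2 ^ t) mod int n), i) a)"
  define keep where "keep = (\<lambda>x a. digit_is False t a \<and> barrel t x a)"
  \<comment> \<open>The two summands \<open>n\<close> pay for the digit functions of this level;
    three layers of \<open>n * q\<close> gates follow, for \<open>rot\<close>, \<open>keep\<close>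
    and their disjunction.\<close>
  define N1 where "N1 = N + 5 * q * n * t + n + n"
  have fin: "finite ?I" and card: "card ?I = n * q"
    by simp_all
  have "computable_within V (N + 5 * q * n * t) S"
    using Suc by (simp add: S_def)
  then have "computable_within V N1 S1"
    unfolding S1_def N1_def using Suc.prems
    by (intro computable_within_digit_is) (auto simp: S_def)
  then have "computable_within V (N1 + n * q) (S1 \<union> rot ` ?I)"
    unfolding card[symmetric]
  proof (rule computable_within_layer[OF fin])
    fix x assume "x \<in> ?I"
    then obtain p i where x: "x = (p, i)" "p < n" "i < q" by auto
    then have "nat ((int p - 2 ^ t) mod int n) < n"
      by (simp add: nat_less_iff)
    then have "barrel t (nat ((int p - 2 ^ t) mod int n), i) \<in> S1"
      using x by (auto simp: S1_def S_def)
    moreover have "digit_is True t \<in> S1"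
      by (simp add: S1_def)
    ultimately show "\<exists>f\<in>S1. \<exists>g\<in>S1. rot x = (\<lambda>a. f a \<and> g a) \<or> rot x = (\<lambda>a. f a \<or> g a)"
      unfolding x(1) rot_def by auto
  qed
  then have "computable_within V (N1 + n * q + n * q) ((S1 \<union> rot ` ?I) \<union> keep ` ?I)"
    unfolding card[symmetric]
  proof (rule computable_within_layer[OF fin])
    fix x assume "x \<in> ?I"
    then have "barrel t x \<in> S1 \<union> rot ` ?I" "digit_is False t \<in> S1 \<union> rot ` ?I"
      by (auto simp: S1_def S_def)
    then show "\<exists>f\<in>S1 \<union> rot ` ?I. \<exists>g\<in>S1 \<union> rot ` ?I.
        keep x = (\<lambda>a. f a \<and> g a) \<or> keep x = (\<lambda>a. f a \<or> g a)"
      unfolding keep_def by blast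
  qed
  then have "computable_within V (N1 + n * q + n * q + n * q)
      (((S1 \<union> rot ` ?I) \<union> keep ` ?I) \<union> barrel (Suc t) ` ?I)"
    unfolding card[symmetric]
  proof (rule computable_within_layer[OF fin])
    fix x assume x: "x \<in> ?I"
    have "barrel (Suc t) x = (\<lambda>a. rot x a \<or> keep x a)"
      by (cases x) (simp add: rot_def keep_def)
    with x show "\<exists>f\<in>S1 \<union> rot ` ?I \<union> keep ` ?I. \<exists>g\<in>S1 \<union> rot ` ?I \<union> keep ` ?I.
        barrel (Suc t) x = (\<lambda>a. f a \<and> g a) \<or> barrel (Suc t) x = (\<lambda>a. f a \<or> g a)"
      by blast
  qed
  then show ?case
  proof (rule computable_within_mono)
    \<comment> \<open>This absorbs the \<open>2 * n\<close> gates for the digits into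
      \<open>2 * q * n\<close>; with the three layers it gives the factor 5.\<close>
    have "n \<le> q * n"
      using \<open>q \<ge> 1\<close> by simp
    then show "N1 + n * q + n * q + n * q \<le> N + 5 * q * n * Suc t"
      by (simp add: N1_def algebra_simps)
  qed (auto simp: S1_def S_def)
qed

end

section \<open>The number of levels and the final bound\<close>

text \<open>\<open>T\<close> is the binary logarithm of \<open>n\<close> rounded up. Minimality
  gives \<open>T - 1 < log 2 n\<close>, and the factor 2 absorbs the rounding because
  \<open>log 2 n\<close> is at least 1.\<close>

lemma obtain_binary_length:
  assumes "n \<ge> 2"
  obtains T where "n \<le> 2 ^ T" "\<And>t. t < T \<Longrightarrow> 2 ^ t < n" "real T \<le> 2 * log 2 (real n)"
proof -
  define T where "T = (LEAST T. n \<le> 2 ^ T)"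
  have n: "n \<le> 2 ^ T"
    unfolding T_def by (rule LeastI[of _ n]) (simp add: less_imp_le)
  have less: "2 ^ t < n" if "t < T" for t
    using not_less_Least[of t "\<lambda>T. n \<le> 2 ^ T"] that by (simp add: T_def)
  have "T \<noteq> 0"
    using n assms by (intro notI) simp
  then have "2 ^ (T - 1) < n"
    by (intro less) simp
  then have "real (T - 1) < log 2 (real n)"
    using less_log_of_power[of 2 "T - 1" "real n"]
    by (metis numeral_power_less_of_nat_cancel_iff one_less_numeral_iff semiring_norm(76))
  moreover have "1 \<le> log 2 (real n)"
    using assms by simp
  ultimately have "real T \<le> 2 * log 2 (real n)"
    by linarith
  with n less show thesis
    by (rule that)
qed

text \<open>The monomial of \<open>u\<close> holds at the point \<open>v\<close> exactly if
  \<open>u\<close> is componentwise below \<open>v\<close>, which in an antichain forces equality.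
  This is the one-hot property.\<close>

lemma monomial_on_antichain:
  assumes "A \<subseteq> {v. length v = m}" "antichain A" "u \<in> A" "v \<in> A"
    and "map y [0..<m] = v"
  shows "monomial u y \<longleftrightarrow> u = v"
proof -
  have "monomial u y \<longleftrightarrow> list_all2 (\<le>) u v"
    using assms(1,3) by (auto simp: monomial_def list_all2_conv_all_nth assms(5)[symmetric])
  moreover have "list_all2 (\<le>) v v"
    by (simp add: list_all2_refl)
  ultimately show ?thesis
    using assms(2-4) by (auto simp: antichain_def)
qed

lemma shift_complexity_le:
  assumes "n \<le> 2 ^ T" "\<And>t. t < T \<Longrightarrow> 2 ^ t < n" "q \<ge> 1"
    and A: "A \<subseteq> {v. length v = m}" "antichain A" "A = \<alpha> ` {..<n}" "inj_on \<alpha> {..<n}"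
    and L: "monomials_complexity m A = enat L"
  shows "shift_complexity q n m \<alpha> \<le> enat (L + 5 * q * n * T)"
proof -
  let ?V = "shift_vars q n m" and ?I = "{..<n} \<times> {..<q}"
  define z where "z = (\<lambda>k (a :: shift_var \<Rightarrow> bool). monomial (\<alpha> k) (a \<circ> Y))"
  have "computable_within ?V L ((\<lambda>v a. monomial v (a \<circ> Y)) ` A \<union> (\<lambda>v a. a v) ` ?V)"
    using L unfolding monomials_complexity_def
    by (rule computable_within_substitute) (auto simp: shift_vars_def)
  \<comment> \<open>Level 0 of the shifter consists of input variables, so no gate is added.\<close>
  then have "computable_within ?V L (z ` {..<n} \<union> barrel n z 0 ` ?I)"
    by (rule computable_within_mono) (auto simp: A(3) z_def shift_vars_def)
  then have "computable_within ?V (L + 5 * q * n * T) (z ` {..<n} \<union> barrel n z T ` ?I)"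
    using assms(2,3) by (rule computable_within_barrel)
  then have "computable_within ?V (L + 5 * q * n * T) (barrel n z T ` ?I)"
    by (rule computable_within_mono) auto
  then show ?thesis
    unfolding shift_complexity_def
  proof (rule complexity_le_if_computable_within)
    fix a b x
    assume b: "shift_operator n m \<alpha> a = Some b" and "x \<in> ?I"
    then obtain p i where x: "x = (p, i)" "p < n" by auto
    obtain k where k: "k < n" "map (\<lambda>i. a (Y i)) [0..<m] = \<alpha> k"
      using b by (auto simp: shift_operator_def Let_def split: if_splits)
    have "z j a \<longleftrightarrow> j = k" if "j < n" for j
    proof -
      have "z j a \<longleftrightarrow> \<alpha> j = \<alpha> k"
        unfolding z_def using k that A(3)
        by (intro monomial_on_antichain[OF A(1,2)]) (auto simp: comp_def)
      then show ?thesis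
        using A(4) k(1) that by (auto dest: inj_onD)
    qed
    then have "barrel n z T (p, i) a = a (X (nat ((int p - int (take_bit T k)) mod int n)) i)"
      using k(1) x(2) by (intro barrel_eq) auto
    \<comment> \<open>Since \<open>k < n \<le> 2 ^ T\<close>, the \<open>T\<close> levels cover all
      digits of \<open>k\<close>.\<close>
    moreover have "take_bit T k = k"
      using k(1) assms(1) by (simp add: take_bit_nat_eq_self)
    moreover have "b = (\<lambda>(p, i). cyclic_shift n (\<lambda>j i. a (X j i)) k p i)"
      using b shift_operator_apply[OF A(4) k] by simp
    ultimately show "barrel n z T x a = b x"
      by (simp add: x(1) cyclic_shift_def)
  qed
qed

theorem theorem1:
  "\<exists>c::real. c > 0 \<and>
     (\<forall>(n::nat) (q::nat) (m::nat) (A :: bool list set) (\<alpha> :: nat \<Rightarrow> bool list).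
        n \<ge> 2 \<longrightarrow> q \<ge> 1 \<longrightarrow> m \<ge> 1 \<longrightarrow>
        A \<subseteq> {v. length v = m} \<longrightarrow> antichain A \<longrightarrow> card A = n \<longrightarrow> A = \<alpha> ` {..<n} \<longrightarrow>
        ereal_of_enat (shift_complexity q n m \<alpha>)
          \<le> ereal_of_enat (monomials_complexity m A) + ereal (c * real q * real n * log 2 (real n)))"
\<comment> \<open>The constant 10 is 5, the gates per level and per entry of the matrix, times 2
  from the bound on \<open>T\<close>.\<close>
proof (intro exI[of _ 10] conjI allI impI)
  fix n q m :: nat and A :: "bool list set" and \<alpha> :: "nat \<Rightarrow> bool list"
  assume n: "n \<ge> 2" and q: "q \<ge> 1"
    and A: "A \<subseteq> {v. length v = m}" "antichain A" "card A = n" "A = \<alpha> ` {..<n}"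
  show "ereal_of_enat (shift_complexity q n m \<alpha>)
      \<le> ereal_of_enat (monomials_complexity m A) + ereal (10 * real q * real n * log 2 (real n))"
  \<comment> \<open>If the value is infinite, the right-hand side is infinite and the bound is
    trivial.\<close>
  proof (cases "monomials_complexity m A")
    case (enat L)
    obtain T where T: "n \<le> 2 ^ T" "\<And>t. t < T \<Longrightarrow> 2 ^ t < n" "real T \<le> 2 * log 2 (real n)"
      using obtain_binary_length[OF n] by blast
    \<comment> \<open>An indexing by \<open>n\<close> numbers of a set with \<open>n\<close>
      elements cannot repeat a value.\<close>
    have "inj_on \<alpha> {..<n}"
      using A(3,4) by (intro eq_card_imp_inj_on) auto
    then have "shift_complexity q n m \<alpha> \<le> enat (L + 5 * q * n * T)"
      using T q A enat by (intro shift_complexity_le)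
    then have "ereal_of_enat (shift_complexity q n m \<alpha>) \<le> ereal_of_enat (enat (L + 5 * q * n * T))"
      by (simp only: ereal_of_enat_le_iff)
    also have "\<dots> = ereal (real L + 5 * real q * real n * real T)"
      by simp
    also have "5 * real q * real n * real T \<le> 5 * real q * real n * (2 * log 2 (real n))"
      using T(3) by (intro mult_left_mono) auto
    finally show ?thesis
      using enat by (simp add: algebra_simps)
  qed simp
qed simp

end
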